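(* For all positive integers $k,m$, every positive integer $\ell$ and all integers $n_1,\ldots,n_\ell\geq 2$, $$R(B_{k,m},K_{n_1},\ldots,K_{n_\ell})=(k+m-1)\bigl[R(K_{n_1},\ldots,K_{n_\ell})-1\bigr]+1.$$
   Context: For graphs $G_1,\ldots,G_s$, $R(G_1,\ldots,G_s)$ is the least integer $N$ such that every edge-coloring of $K_N$ with $s$ colors $1,\ldots,s$ contains, for some $i$, a copy of $G_i$ all of whose edges have color $i$. $B_{k,m}$ denotes the bistar on $k+m$ vertices: a vertex $v$ of degree $k$, a vertex $w$ adjacent to $v$ of degree $m$, and $k+m-2$ further vertices of degree $1$. $K_n$ is the complete graph on $n$ vertices. *)

theory Defs
  imports Complex_Main "HOL-Library.Ramsey"
begin

text \<open>A simple graph on natural-number vertices is a pair of a vertex set and a set of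
  two-element subsets of it; \<open>nsets V 2\<close> is the set of all such subsets.\<close>

type_synonym graph = "nat set \<times> nat set set"

abbreviation verts :: "graph \<Rightarrow> nat set" where "verts \<equiv> fst"
abbreviation edges :: "graph \<Rightarrow> nat set set" where "edges \<equiv> snd"

definition is_graph :: "graph \<Rightarrow> bool" where
  "is_graph G \<longleftrightarrow> finite (verts G) \<and> edges G \<subseteq> nsets (verts G) 2"

definition degree :: "graph \<Rightarrow> nat \<Rightarrow> nat" where
  "degree G v = card {e \<in> edges G. v \<in> e}"

definition complete_graph :: "nat \<Rightarrow> graph" where
  "complete_graph n = ({..<n}, nsets {..<n} 2)"

text \<open>The adjacent centres are the vertices 0 and 1; the leaves at 0 are \<open>2, \<dots>, k\<close> and the
  leaves at 1 are \<open>k + 1, \<dots>, k + m - 1\<close>.\<close>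

definition bistar :: "nat \<Rightarrow> nat \<Rightarrow> graph" where
  "bistar k m =
     ({..<k + m}, insert {0, 1} ({{0, x} |x. x \<in> {2..<k + 1}} \<union> {{1, y} |y. y \<in> {k + 1..<k + m}}))"

text \<open>An edge-colouring need not use all colours. The colour classes are indexed from 0, in
  agreement with list indexing.\<close>

definition edge_coloring :: "nat \<Rightarrow> graph \<Rightarrow> (nat set \<Rightarrow> nat) \<Rightarrow> bool" where
  "edge_coloring s G c \<longleftrightarrow> c \<in> edges G \<rightarrow> {..<s}"

definition mono_copy :: "graph \<Rightarrow> (nat set \<Rightarrow> nat) \<Rightarrow> nat \<Rightarrow> graph \<Rightarrow> bool" where
  "mono_copy K c i H \<longleftrightarrow>
     (\<exists>\<phi>. inj_on \<phi> (verts H) \<and> \<phi> ` verts H \<subseteq> verts K \<and>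
          (\<forall>e \<in> edges H. \<phi> ` e \<in> edges K \<and> c (\<phi> ` e) = i))"

definition arrows :: "nat \<Rightarrow> graph list \<Rightarrow> bool" where
  "arrows N Gs \<longleftrightarrow>
     (\<forall>c. edge_coloring (length Gs) (complete_graph N) c \<longrightarrow>
          (\<exists>i < length Gs. mono_copy (complete_graph N) c i (Gs ! i)))"

definition ramsey_number :: "graph list \<Rightarrow> nat" where
  "ramsey_number Gs = (LEAST N. arrows N Gs)"

lemma is_graph_complete_graph: "is_graph (complete_graph n)"
  by (simp add: is_graph_def complete_graph_def)

lemma is_graph_bistar:
  assumes "k \<ge> 1" "m \<ge> 1"
  shows "is_graph (bistar k m)"
  using assms by (auto simp: is_graph_def bistar_def)

lemma card_verts_bistar: "card (verts (bistar k m)) = k + m"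
  by (simp add: bistar_def)

lemma centres_adjacent_bistar: "{0, 1} \<in> edges (bistar k m)"
  by (simp add: bistar_def)

lemma degree_bistar_0:
  assumes "k \<ge> 1"
  shows "degree (bistar k m) 0 = k"
proof -
  have "{e \<in> edges (bistar k m). 0 \<in> e} = (\<lambda>x. {0, x}) ` insert 1 {2..<k + 1}"
    unfolding bistar_def by fastforce
  moreover have "inj_on (\<lambda>x. {0::nat, x}) (insert 1 {2..<k + 1})"
    unfolding inj_on_def doubleton_eq_iff by metis
  ultimately show ?thesis
    using assms by (simp add: degree_def card_image)
qed

lemma degree_bistar_1:
  assumes "k \<ge> 1" "m \<ge> 1"
  shows "degree (bistar k m) 1 = m"
proof -
  have "{e \<in> edges (bistar k m). 1 \<in> e} = (\<lambda>x. {1, x}) ` insert 0 {k + 1..<k + m}"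
    unfolding bistar_def by fastforce
  moreover have "inj_on (\<lambda>x. {1::nat, x}) (insert 0 {k + 1..<k + m})"
    unfolding inj_on_def doubleton_eq_iff by metis
  ultimately show ?thesis
    using assms by (simp add: degree_def card_image)
qed

lemma degree_bistar_leaf:
  assumes "k \<ge> 1" "v \<in> {2..<k + m}"
  shows "degree (bistar k m) v = 1"
proof (cases "v < k + 1")
  case True
  then have "{e \<in> edges (bistar k m). v \<in> e} = {{0, v}}"
    using assms by (auto simp: bistar_def)
  then show ?thesis by (simp add: degree_def)
next
  case False
  then have "{e \<in> edges (bistar k m). v \<in> e} = {{1, v}}"
    using assms by (auto simp: bistar_def)
  then show ?thesis by (simp add: degree_def)
qed

text \<open>By Ramsey's theorem the least number in the definition of \<^const>\<open>ramsey_number\<close> exists.\<close>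

lemma ex_arrows:
  assumes "\<And>G. G \<in> set Gs \<Longrightarrow> is_graph G"
  shows "\<exists>N. arrows N Gs"
proof -
  obtain N :: nat where N: "partn_lst {..<N} (map (\<lambda>G. card (verts G)) Gs) 2"
    using ramsey_full by blast
  have "arrows N Gs"
    unfolding arrows_def
  proof (intro allI impI)
    fix c
    assume "edge_coloring (length Gs) (complete_graph N) c"
    then have "c \<in> nsets {..<N} 2 \<rightarrow> {..<length Gs}"
      by (simp add: edge_coloring_def complete_graph_def)
    with N obtain i where i: "i < length Gs"
      and "monochromatic {..<N} (map (\<lambda>G. card (verts G)) Gs ! i) 2 c i"
      unfolding partn_lst_def length_map by blast
    then obtain H where H: "H \<in> nsets {..<N} (card (verts (Gs ! i)))"
      and mono: "c ` nsets H 2 \<subseteq> {i}"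
      by (auto simp: monochromatic_def)
    have G: "is_graph (Gs ! i)" using assms i by simp
    have "finite H" "card H = card (verts (Gs ! i))" and HN: "H \<subseteq> {..<N}"
      using H by (auto simp: nsets_def)
    then obtain \<phi> where \<phi>: "bij_betw \<phi> (verts (Gs ! i)) H"
      using G by (metis finite_same_card_bij is_graph_def)
    have "\<phi> ` e \<in> nsets H 2" if "e \<in> edges (Gs ! i)" for e
    proof -
      have e: "e \<subseteq> verts (Gs ! i)" "finite e" "card e = 2"
        using that G unfolding is_graph_def nsets_def by blast+
      then have "inj_on \<phi> e" "\<phi> ` e \<subseteq> H"
        using \<phi> unfolding bij_betw_def by (blast intro: inj_on_subset)+
      then show ?thesis
        using e by (simp add: nsets_def card_image)
    qed
    then have "\<phi> ` e \<in> nsets {..<N} 2 \<and> c (\<phi> ` e) = i" if "e \<in> edges (Gs ! i)" for e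
      using that mono nsets_mono[OF HN, of 2] by blast
    moreover have "inj_on \<phi> (verts (Gs ! i))" "\<phi> ` verts (Gs ! i) \<subseteq> {..<N}"
      using \<phi> HN by (auto simp: bij_betw_def)
    ultimately have "mono_copy (complete_graph N) c i (Gs ! i)"
      unfolding mono_copy_def complete_graph_def by auto
    with i show "\<exists>i < length Gs. mono_copy (complete_graph N) c i (Gs ! i)" by blast
  qed
  then show ?thesis ..
qed

end

theory Submission
  imports Defs
begin

text \<open>
  Upper bound: put \<open>t = k + m\<close>. A colouring of \<open>K\<^sub>N\<close> with \<open>N > (t - 1) (R - 1)\<close> either has a
  vertex set inducing minimum degree at least \<open>t - 1\<close> in colour 0, into which the bistar embeds
  greedily, or colour 0 is \<open>(t - 2)\<close>-degenerate, hence has an independent set of size \<open>R\<close>, to which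
  the definition of \<open>R\<close> applies. Lower bound: blow up each vertex of an extremal colouring
  of \<open>K\<^bsub>R-1\<^esub>\<close> into a clique of \<open>t - 1\<close> vertices in colour 0.
\<close>

section \<open>Greedy arguments for an adjacency relation\<close>

text \<open>Pick a vertex \<open>v\<close> with fewer than \<open>d\<close> neighbours in
  \<open>V\<close> and delete it together with them. Since \<open>v\<close> is adjacent to nothing
  that remains, it extends any independent set of the rest, and each vertex chosen in this way uses
  up at most \<open>d\<close> vertices of \<open>V\<close>. The degree condition ranges over all
  nonempty subsets, so it passes to the rest.\<close>

lemma degenerate_imp_independent_set:
  fixes adj :: "'a \<Rightarrow> 'a \<Rightarrow> bool"
  assumes "finite V" and sym: "\<And>x y. adj x y \<Longrightarrow> adj y x"
    and "\<And>U. \<lbrakk>U \<subseteq> V; U \<noteq> {}\<rbrakk> \<Longrightarrow> \<exists>v\<in>U. card {u \<in> U. u \<noteq> v \<and> adj v u} < d"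
  shows "\<exists>I \<subseteq> V. (\<forall>x\<in>I. \<forall>y\<in>I. x \<noteq> y \<longrightarrow> \<not> adj x y) \<and> card V \<le> d * card I"
  using assms(1,3)
proof (induction V rule: finite_psubset_induct)
  case (psubset V)
  show ?case
  proof (cases "V = {}")
    case True
    then show ?thesis by auto
  next
    case False
    then obtain v where v: "v \<in> V" and dv: "card {u \<in> V. u \<noteq> v \<and> adj v u} < d"
      using psubset.prems by blast
    define M where "M = {u \<in> V. u \<noteq> v \<and> adj v u}"
    define W where "W = V - insert v M"
    have "W \<subset> V" using v by (auto simp: W_def)
    then obtain I where I: "I \<subseteq> W" and ind: "\<forall>x\<in>I. \<forall>y\<in>I. x \<noteq> y \<longrightarrow> \<not> adj x y"
      and cI: "card W \<le> d * card I"
      using psubset.IH[of W] psubset.prems by (meson order_trans psubset_imp_subset)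
    have fM: "finite M" using psubset.hyps by (simp add: M_def)
    have "v \<notin> I" using I by (auto simp: W_def)
    moreover have "finite I"
      using I psubset.hyps by (auto simp: W_def intro: finite_subset)
    ultimately have "card (insert v I) = Suc (card I)" by simp
    moreover have "card V \<le> d + card W"
    proof -
      have "card V \<le> card (insert v M \<union> W)"
        using psubset.hyps fM by (intro card_mono) (auto simp: W_def)
      also have "\<dots> \<le> card (insert v M) + card W" by (rule card_Un_le)
      also have "card (insert v M) \<le> d"
        using dv fM by (simp add: M_def card_insert_if)
      finally show ?thesis by simp
    qed
    moreover have "\<not> adj v y" "\<not> adj y v" if "y \<in> I" for y
      using that I \<open>v \<notin> I\<close> sym by (auto simp: W_def M_def)
    then have "\<forall>x\<in>insert v I. \<forall>y\<in>insert v I. x \<noteq> y \<longrightarrow> \<not> adj x y"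
      using ind by blast
    moreover have "insert v I \<subseteq> V" using v I by (auto simp: W_def)
    ultimately show ?thesis
      using cI by (intro exI[of _ "insert v I"]) auto
  qed
qed

text \<open>Any \<open>v\<close> in \<open>U\<close> and any neighbour \<open>w\<close> serve as
  centres. First choose \<open>k - 1\<close> leaves \<open>A\<close> at \<open>v\<close>. Of the at
  least \<open>k + m - 1\<close> neighbours of \<open>w\<close>, discarding \<open>v\<close> and
  \<open>A\<close> costs at most \<open>k\<close>, which leaves the \<open>m - 1\<close> needed for
  \<open>B\<close>.\<close>

lemma bistar_embeds:
  assumes k: "k \<ge> 1" and m: "m \<ge> 1" and "finite U" "U \<noteq> {}"
    and sym: "\<And>x y. adj x y \<Longrightarrow> adj y x"
    and deg: "\<And>v. v \<in> U \<Longrightarrow> card {u \<in> U. u \<noteq> v \<and> adj v u} \<ge> k + m - 1"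
  obtains \<phi> :: "nat \<Rightarrow> 'a" where "inj_on \<phi> {..<k + m}" "\<phi> ` {..<k + m} \<subseteq> U"
    "adj (\<phi> 0) (\<phi> 1)" "\<And>x. x \<in> {2..<k + 1} \<Longrightarrow> adj (\<phi> 0) (\<phi> x)"
    "\<And>y. y \<in> {k + 1..<k + m} \<Longrightarrow> adj (\<phi> 1) (\<phi> y)"
proof -
  define nb where "nb v = {u \<in> U. u \<noteq> v \<and> adj v u}" for v
  have fin: "finite (nb v)" for v using \<open>finite U\<close> by (simp add: nb_def)
  have deg: "card (nb v) \<ge> k + m - 1" if "v \<in> U" for v
    using deg[OF that] by (simp add: nb_def)
  obtain v where v: "v \<in> U" using \<open>U \<noteq> {}\<close> by blast
  have "nb v \<noteq> {}" using deg[OF v] k m by auto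
  then obtain w where w: "w \<in> nb v" by blast
  have wU: "w \<in> U" and wv: "w \<noteq> v" and vw: "v \<in> nb w"
    using w v sym by (auto simp: nb_def)
  have "card (nb v - {w}) \<ge> k - 1"
    using deg[OF v] w fin m by (simp add: card_Diff_singleton)
  then obtain A where A: "A \<subseteq> nb v - {w}" "card A = k - 1" "finite A"
    by (rule obtain_subset_with_card_n)
  have "card (nb w - {v}) - card A \<le> card (nb w - {v} - A)"
    by (rule diff_card_le_card_Diff) (rule A)
  then have "card (nb w - {v} - A) \<ge> m - 1"
    using deg[OF wU] vw fin A k by (simp add: card_Diff_singleton)
  then obtain B where B: "B \<subseteq> nb w - {v} - A" "card B = m - 1" "finite B"
    by (rule obtain_subset_with_card_n)
  obtain f where f: "bij_betw f {2..<k + 1} A"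
    using finite_same_card_bij[of "{2..<k + 1}" A] A by auto
  obtain g where g: "bij_betw g {k + 1..<k + m} B"
    using finite_same_card_bij[of "{k + 1..<k + m}" B] B by auto
  \<comment> \<open>The cases follow the vertex numbering of \<open>bistar\<close>: two centres,
    then the leaves at 0, then the leaves at 1. Injectivity comes from gluing four bijections with
    disjoint images.\<close>
  define \<phi> where
    "\<phi> x = (if x = 0 then v else if x = 1 then w else if x < k + 1 then f x else g x)" for x
  have \<phi>_eq: "\<phi> 0 = v" "\<phi> 1 = w" "\<And>x. x \<in> {2..<k + 1} \<Longrightarrow> \<phi> x = f x"
    "\<And>x. x \<in> {k + 1..<k + m} \<Longrightarrow> \<phi> x = g x"
    using k by (auto simp: \<phi>_def)
  have dom: "{..<k + m} = {0} \<union> ({1} \<union> ({2..<k + 1} \<union> {k + 1..<k + m}))"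
    using k m by auto
  have bA: "bij_betw \<phi> {2..<k + 1} A"
    by (rule iffD2[OF bij_betw_cong[OF \<phi>_eq(3)] f])
  have bB: "bij_betw \<phi> {k + 1..<k + m} B"
    by (rule iffD2[OF bij_betw_cong[OF \<phi>_eq(4)] g])
  have b0: "bij_betw \<phi> {0} {v}" and b1: "bij_betw \<phi> {1} {w}"
    by (simp_all add: bij_betw_def \<phi>_def)
  have im: "\<phi> ` {2..<k + 1} = A" "\<phi> ` {k + 1..<k + m} = B"
    using bA bB by (simp_all only: bij_betw_def)
  have disj: "v \<notin> A" "v \<notin> B" "w \<notin> A" "w \<notin> B" "A \<inter> B = {}"
    using A B by (auto simp: nb_def)
  show thesis
  proof
    have "bij_betw \<phi> ({2..<k + 1} \<union> {k + 1..<k + m}) (A \<union> B)"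
      using disj by (intro bij_betw_combine[OF bA bB])
    then have "bij_betw \<phi> ({1} \<union> ({2..<k + 1} \<union> {k + 1..<k + m})) ({w} \<union> (A \<union> B))"
      using disj by (intro bij_betw_combine[OF b1]) auto
    then have "bij_betw \<phi> {..<k + m} ({v} \<union> ({w} \<union> (A \<union> B)))"
      unfolding dom using disj wv by (intro bij_betw_combine[OF b0]) auto
    then show "inj_on \<phi> {..<k + m}" "\<phi> ` {..<k + m} \<subseteq> U"
      using v wU A B by (auto simp: bij_betw_def nb_def)
    show "adj (\<phi> 0) (\<phi> 1)" using w by (simp only: \<phi>_eq) (simp add: nb_def)
    show "adj (\<phi> 0) (\<phi> x)" if "x \<in> {2..<k + 1}" for x
    proof -
      have "\<phi> x \<in> nb v" using im that A by blast
      then show ?thesis by (simp only: \<phi>_eq) (simp add: nb_def)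
    qed
    show "adj (\<phi> 1) (\<phi> y)" if "y \<in> {k + 1..<k + m}" for y
    proof -
      have "\<phi> y \<in> nb w" using im that B by blast
      then show ?thesis by (simp only: \<phi>_eq) (simp add: nb_def)
    qed
  qed
qed

section \<open>Upper bound: finding the bistar or a copy from the other list\<close>

lemma image_in_nsets:
  assumes "inj_on h A" "h ` A \<subseteq> B" "e \<in> nsets A n"
  shows "h ` e \<in> nsets B n"
  using assms by (auto simp: nsets_def card_image inj_on_subset)

lemma arrows_bistar_Cons:
  assumes k: "k \<ge> 1" and m: "m \<ge> 1" and R: "arrows R Gs"
  shows "arrows ((k + m - 1) * (R - 1) + 1) (bistar k m # Gs)"
  unfolding arrows_def
proof (intro allI impI)
  define N where "N = (k + m - 1) * (R - 1) + 1"
  fix c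
  assume "edge_coloring (length (bistar k m # Gs)) (complete_graph N) c"
  then have c: "c e < Suc (length Gs)" if "e \<in> nsets {..<N} 2" for e
    using that by (auto simp: edge_coloring_def complete_graph_def)
  define adj where "adj x y \<longleftrightarrow> c {x, y} = 0" for x y
  have sym: "adj x y \<Longrightarrow> adj y x" for x y by (simp add: adj_def insert_commute)
  show "\<exists>i < length (bistar k m # Gs).
          mono_copy (complete_graph N) c i ((bistar k m # Gs) ! i)"
  \<comment> \<open>The negation of this condition is exactly the degeneracy hypothesis with
    \<open>d = k + m - 1\<close>, so each case feeds one of the two greedy lemmas.\<close>
  proof (cases "\<exists>U \<subseteq> {..<N}. U \<noteq> {} \<and>
                  (\<forall>v\<in>U. card {u \<in> U. u \<noteq> v \<and> adj v u} \<ge> k + m - 1)")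
    case True
    then obtain U where U: "U \<subseteq> {..<N}" "U \<noteq> {}"
      and deg: "\<And>v. v \<in> U \<Longrightarrow> card {u \<in> U. u \<noteq> v \<and> adj v u} \<ge> k + m - 1" by blast
    obtain \<phi> where \<phi>: "inj_on \<phi> {..<k + m}" "\<phi> ` {..<k + m} \<subseteq> U"
      "adj (\<phi> 0) (\<phi> 1)" "\<And>x. x \<in> {2..<k + 1} \<Longrightarrow> adj (\<phi> 0) (\<phi> x)"
      "\<And>y. y \<in> {k + 1..<k + m} \<Longrightarrow> adj (\<phi> 1) (\<phi> y)"
      using bistar_embeds[OF k m finite_subset[OF U(1) finite_lessThan] U(2) sym deg] by metis
    have "mono_copy (complete_graph N) c 0 (bistar k m)"
      unfolding mono_copy_def
    proof (intro exI conjI ballI)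
      show "inj_on \<phi> (verts (bistar k m))" using \<phi>(1) by (simp add: bistar_def)
      show "\<phi> ` verts (bistar k m) \<subseteq> verts (complete_graph N)"
        using \<phi>(2) U(1) by (simp add: bistar_def complete_graph_def)
      fix e assume e: "e \<in> edges (bistar k m)"
      then have "e \<in> nsets {..<k + m} 2"
        using is_graph_bistar[OF k m] by (auto simp: is_graph_def bistar_def)
      then show "\<phi> ` e \<in> edges (complete_graph N)"
        using \<phi>(1,2) U(1) by (auto simp: complete_graph_def intro!: image_in_nsets)
      show "c (\<phi> ` e) = 0"
        using e \<phi>(3-5) by (auto simp: bistar_def adj_def)
    qed
    then show ?thesis by auto
  next
    case False
    have "\<exists>I \<subseteq> {..<N}. (\<forall>x\<in>I. \<forall>y\<in>I. x \<noteq> y \<longrightarrow> \<not> adj x y)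
            \<and> card {..<N} \<le> (k + m - 1) * card I"
      using False by (intro degenerate_imp_independent_set) (auto simp: sym not_le)
    then obtain I where I: "I \<subseteq> {..<N}" and ind: "\<And>x y. \<lbrakk>x \<in> I; y \<in> I; x \<noteq> y\<rbrakk> \<Longrightarrow> \<not> adj x y"
      and cI: "N \<le> (k + m - 1) * card I" by auto
    \<comment> \<open>The summand 1 in \<open>N\<close> makes this inequality strict, which forces
      \<open>card I\<close> above \<open>R - 1\<close>.\<close>
    have "(k + m - 1) * (R - 1) < (k + m - 1) * card I"
      using cI unfolding N_def by linarith
    then have "R - 1 < card I" using mult_less_cancel1 by blast
    then have "R \<le> card I" by linarith
    then obtain J where J: "J \<subseteq> I" "card J = R" "finite J"
      by (rule obtain_subset_with_card_n)
    \<comment> \<open>Relabelling \<open>J\<close> by \<open>h\<close> pulls the colouring back to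
      \<open>complete_graph R\<close>, where the hypothesis on \<open>R\<close> applies.\<close>
    then obtain h where "bij_betw h {..<R} J"
      using finite_same_card_bij[of "{..<R}" J] by auto
    then have h: "inj_on h {..<R}" "h ` {..<R} = J" by (auto simp: bij_betw_def)
    have hN: "h ` e \<in> nsets {..<N} 2" if "e \<in> nsets {..<R} 2" for e
      using that h J I by (auto intro!: image_in_nsets[of h "{..<R}"])
    \<comment> \<open>Colour 0 is absent on \<open>J\<close>, so lowering every colour by 1 is never
      truncated: it gives a colouring indexed by \<open>Gs\<close>, and colour \<open>i\<close>
      found there is colour \<open>Suc i\<close> of \<open>c\<close>.\<close>
    have nz: "c (h ` e) \<noteq> 0" if "e \<in> nsets {..<R} 2" for e
    proof -
      have "h ` e \<in> nsets J 2" using that h by (auto intro!: image_in_nsets)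
      then obtain x y where "h ` e = {x, y}" "x \<in> J" "y \<in> J" "x \<noteq> y"
        by (auto simp: nsets_2_eq)
      then show ?thesis using ind J(1) by (auto simp: adj_def)
    qed
    have "c (h ` e) - 1 < length Gs" if "e \<in> nsets {..<R} 2" for e
      using c[OF hN[OF that]] nz[OF that] by linarith
    then have "edge_coloring (length Gs) (complete_graph R) (\<lambda>e. c (h ` e) - 1)"
      by (auto simp: edge_coloring_def complete_graph_def)
    with R obtain i where i: "i < length Gs"
      and "mono_copy (complete_graph R) (\<lambda>e. c (h ` e) - 1) i (Gs ! i)"
      unfolding arrows_def by blast
    then obtain \<phi> where \<phi>: "inj_on \<phi> (verts (Gs ! i))"
      "\<phi> ` verts (Gs ! i) \<subseteq> {..<R}"
      "\<And>e. e \<in> edges (Gs ! i) \<Longrightarrow> \<phi> ` e \<in> nsets {..<R} 2 \<and> c (h ` \<phi> ` e) - 1 = i"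
      unfolding mono_copy_def complete_graph_def fst_conv snd_conv by blast
    have "mono_copy (complete_graph N) c (Suc i) (Gs ! i)"
      unfolding mono_copy_def
    proof (intro exI conjI ballI)
      show "inj_on (h \<circ> \<phi>) (verts (Gs ! i))"
        using \<phi>(1,2) h(1) by (meson comp_inj_on inj_on_subset)
      show "(h \<circ> \<phi>) ` verts (Gs ! i) \<subseteq> verts (complete_graph N)"
        using \<phi>(2) h(2) J(1) I by (auto simp: complete_graph_def)
      fix e assume "e \<in> edges (Gs ! i)"
      note e = \<phi>(3)[OF this]
      then show "(h \<circ> \<phi>) ` e \<in> edges (complete_graph N)"
        using hN unfolding complete_graph_def image_comp[symmetric] snd_conv by blast
      show "c ((h \<circ> \<phi>) ` e) = Suc i"
        using e nz[of "\<phi> ` e"] unfolding image_comp[symmetric] by linarith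
    qed
    with i show ?thesis by (intro exI[of _ "Suc i"]) simp
  qed
qed

section \<open>Lower bound: blowing up a colouring\<close>

text \<open>A bistar in colour 0 is connected, so it would lie in one block, which is too small by
  one vertex. A clique in another colour meets each block at most once, so it projects to a clique
  of the original colouring. Allowing every \<open>N\<close> up to the bound makes a separate
  monotonicity argument for \<open>arrows\<close> unnecessary.\<close>

lemma not_arrows_bistar_Cons:
  assumes k: "k \<ge> 1" and m: "m \<ge> 1"
    and r: "\<not> arrows r (map complete_graph ns)" and N: "N \<le> (k + m - 1) * r"
  shows "\<not> arrows N (bistar k m # map complete_graph ns)"
proof -
  obtain c where c: "edge_coloring (length ns) (complete_graph r) c"
    and no: "\<And>i. i < length ns \<Longrightarrow> \<not> mono_copy (complete_graph r) c i (complete_graph (ns ! i))"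
    using r by (auto simp: arrows_def)
  define t where "t = k + m - 1"
  have t: "t > 0" using k m by (simp add: t_def)
  \<comment> \<open>Block \<open>q\<close> consists of the \<open>t\<close> consecutive numbers with
    quotient \<open>q\<close>, and it stands for vertex \<open>q\<close> of the small graph.\<close>
  define p where "p x = x div t" for x
  \<comment> \<open>The image of an edge under \<open>p\<close> has one element exactly when the
    edge stays inside a block. The other edges inherit the colour between their blocks, raised by 1
    to make room for the bistar's colour.\<close>
  define d where "d e = (if card (p ` e) = 1 then 0 else Suc (c (p ` e)))" for e
  have p: "p x < r" if "x < N" for x
    using that N t by (simp add: p_def t_def less_mult_imp_div_less mult.commute)
  have d_less: "d e < Suc (length ns)" if e2: "e \<in> nsets {..<N} 2" for e
  proof -
    obtain x y where e: "e = {x, y}" "x < N" "y < N" using e2 unfolding nsets_2_eq by blast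
    show ?thesis
    proof (cases "p x = p y")
      case False
      then have "p ` e \<in> nsets {..<r} 2" using e p by (auto simp: nsets_2_eq)
      then have "c (p ` e) < length ns"
        using c by (auto simp: edge_coloring_def complete_graph_def)
      then show ?thesis by (simp add: d_def)
    qed (simp add: d_def e)
  qed
  have d0: "p x = p y" if "d {x, y} = 0" for x y
    using that by (auto simp: d_def card_insert_if split: if_splits)
  have "\<not> mono_copy (complete_graph N) d 0 (bistar k m)"
  proof
    assume "mono_copy (complete_graph N) d 0 (bistar k m)"
    then obtain \<phi> where "inj_on \<phi> (verts (bistar k m))"
      and \<phi>: "\<And>e. e \<in> edges (bistar k m) \<Longrightarrow> d (\<phi> ` e) = 0"
      unfolding mono_copy_def by blast
    then have inj: "inj_on \<phi> {..<k + m}" by (simp add: bistar_def)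
    have e: "p (\<phi> x) = p (\<phi> y)" if "{x, y} \<in> edges (bistar k m)" for x y
      using \<phi>[OF that] d0 by simp
    have p1: "p (\<phi> 1) = p (\<phi> 0)"
      using e[of 0 1] centres_adjacent_bistar by simp
    \<comment> \<open>Edges of colour 0 stay inside a block, and every vertex of the bistar is
      reached from centre 0 in at most two edges.\<close>
    have pall: "p (\<phi> x) = p (\<phi> 0)" if x: "x < k + m" for x
    proof -
      consider "x = 0" | "x = 1" | "x \<in> {2..<k + 1}" | "x \<in> {k + 1..<k + m}"
        using x by fastforce
      then show ?thesis
      proof cases
        case 3
        then have "{0, x} \<in> edges (bistar k m)" unfolding bistar_def snd_conv by blast
        then show ?thesis using e[of 0 x] by simp
      next
        case 4
        then have "{1, x} \<in> edges (bistar k m)" unfolding bistar_def snd_conv by blast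
        then show ?thesis using e[of 1 x] p1 by simp
      qed (use p1 in auto)
    qed
    define q where "q = p (\<phi> 0)"
    have "\<phi> ` {..<k + m} \<subseteq> {q * t..<q * t + t}"
    proof (rule image_subsetI)
      fix x assume "x \<in> {..<k + m}"
      then have "\<phi> x div t = q" using pall by (simp add: p_def q_def)
      then show "\<phi> x \<in> {q * t..<q * t + t}"
        using dividend_less_div_times[OF t, of "\<phi> x"] by (auto simp: add.commute)
    qed
    then have "card (\<phi> ` {..<k + m}) \<le> t"
      using card_mono[of "{q * t..<q * t + t}"] by fastforce
    then show False using inj k by (simp add: card_image t_def)
  qed
  moreover have "\<not> mono_copy (complete_graph N) d (Suc i) (complete_graph (ns ! i))"
    if i: "i < length ns" for i
  proof
    assume "mono_copy (complete_graph N) d (Suc i) (complete_graph (ns ! i))"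
    then obtain \<phi> where "inj_on \<phi> {..<ns ! i}" and \<phi>N: "\<phi> ` {..<ns ! i} \<subseteq> {..<N}"
      and \<phi>: "\<And>e. e \<in> nsets {..<ns ! i} 2 \<Longrightarrow> d (\<phi> ` e) = Suc i"
      by (auto simp: mono_copy_def complete_graph_def)
    \<comment> \<open>Any two vertices of a clique are joined, here in a nonzero colour, so they lie
      in different blocks. Hence \<open>p\<close> is injective on the copy.\<close>
    have ne: "p (\<phi> x) \<noteq> p (\<phi> y)" if "x < ns ! i" "y < ns ! i" "x \<noteq> y" for x y
    proof -
      have "{x, y} \<in> nsets {..<ns ! i} 2" using that by (simp add: nsets_def)
      then show ?thesis using \<phi>[of "{x, y}"] by (auto simp: d_def)
    qed
    have "mono_copy (complete_graph r) c i (complete_graph (ns ! i))"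
      unfolding mono_copy_def
    proof (intro exI conjI ballI)
      show inj: "inj_on (p \<circ> \<phi>) (verts (complete_graph (ns ! i)))"
        using ne by (auto simp: inj_on_def complete_graph_def)
      show sub: "(p \<circ> \<phi>) ` verts (complete_graph (ns ! i)) \<subseteq> verts (complete_graph r)"
        using \<phi>N p by (auto simp: complete_graph_def)
      fix e assume "e \<in> edges (complete_graph (ns ! i))"
      then have e: "e \<in> nsets {..<ns ! i} 2" by (simp add: complete_graph_def)
      show "(p \<circ> \<phi>) ` e \<in> edges (complete_graph r)"
        using image_in_nsets[OF inj sub] e by (simp add: complete_graph_def)
      show "c ((p \<circ> \<phi>) ` e) = i"
        using \<phi>[OF e] unfolding image_comp[symmetric] by (auto simp: d_def split: if_splits)
    qed
    with no[OF i] show False by contradiction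
  qed
  ultimately have "\<not> mono_copy (complete_graph N) d i
      ((bistar k m # map complete_graph ns) ! i)" if "i < Suc (length ns)" for i
    using that by (cases i) auto
  moreover have "edge_coloring (Suc (length ns)) (complete_graph N) d"
    using d_less by (auto simp: edge_coloring_def complete_graph_def)
  ultimately show ?thesis by (auto simp: arrows_def)
qed

section \<open>Combining the two bounds\<close>

theorem theorem10:
  fixes k m :: nat and ns :: "nat list"
  assumes "k \<ge> 1" and "m \<ge> 1"
    and "length ns \<ge> 1"
    and "\<forall>n \<in> set ns. n \<ge> 2"
  shows "int (ramsey_number (bistar k m # map complete_graph ns)) =
         (int k + int m - 1) * (int (ramsey_number (map complete_graph ns)) - 1) + 1"
proof -
  define R where "R = ramsey_number (map complete_graph ns)"
  have R: "arrows R (map complete_graph ns)"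
    unfolding R_def ramsey_number_def
    by (rule LeastI_ex, rule ex_arrows) (auto simp: is_graph_complete_graph)
  \<comment> \<open>A graph without vertices has no room for cliques of order at least 2. So
    \<open>R\<close> is positive, \<open>R - 1\<close> really lies below the minimum
    \<open>R\<close>, and an extremal colouring on \<open>R - 1\<close> vertices exists.\<close>
  have "\<not> arrows 0 (map complete_graph ns)"
  proof -
    have "\<not> mono_copy (complete_graph 0) (\<lambda>_. 0) i (complete_graph (ns ! i))"
      if "i < length ns" for i
    proof -
      have "ns ! i \<ge> 2" using assms(4) that by simp
      then show ?thesis by (auto simp: mono_copy_def complete_graph_def lessThan_empty_iff)
    qed
    moreover have "edge_coloring (length ns) (complete_graph 0) (\<lambda>_. 0)"
      by (auto simp: edge_coloring_def complete_graph_def nsets_def)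
    ultimately show ?thesis by (auto simp: arrows_def)
  qed
  then have R0: "R \<ge> 1" using R by (cases R) auto
  have "\<not> arrows (R - 1) (map complete_graph ns)"
    using R0 by (intro not_less_Least) (simp add: R_def ramsey_number_def)
  note lower = not_arrows_bistar_Cons[OF assms(1,2) this]
  have "ramsey_number (bistar k m # map complete_graph ns) = (k + m - 1) * (R - 1) + 1"
    unfolding ramsey_number_def
  proof (rule Least_equality)
    show "arrows ((k + m - 1) * (R - 1) + 1) (bistar k m # map complete_graph ns)"
      by (rule arrows_bistar_Cons[OF assms(1,2) R])
    show "(k + m - 1) * (R - 1) + 1 \<le> N" if "arrows N (bistar k m # map complete_graph ns)" for N
      using that lower[of N] by (cases "N \<le> (k + m - 1) * (R - 1)") auto
  qed
  \<comment> \<open>The bounds \<open>R \<ge> 1\<close> and \<open>k \<ge> 1\<close> ensure that the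
    natural-number subtractions agree with those over the integers.\<close>
  then show ?thesis using R0 assms(1) by (simp add: R_def of_nat_diff)
qed

end
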